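(* Let $\mathcal{A}\subset\mathbb{Z}^d$ be a finite set whose convex hull $\Delta$ has dimension $d$, and let $w=(w_{\mathbf a}\mid\mathbf a\in\mathcal{A})\in\mathbb{R}_{>0}^{\mathcal{A}}$ be positive weights. Iterative proportional fitting computes the unique parametrization of the toric patch of shape $(\mathcal{A},w)$ having linear precision. That is, let $\{\beta_{\mathbf a}\mid\mathbf a\in\mathcal{A}\}$ be the normalized blending functions on $\Delta$ of the unique parametrization of $X_{\mathcal{A},w}$ having linear precision; then for every $y\in\Delta$ the sequence $\mathbf p^{(0)},\mathbf p^{(1)},\mathbf p^{(2)},\dotsc$ produced by iterative proportional fitting with input $y$ converges to $(\beta_{\mathbf a}(y)\mid\mathbf a\in\mathcal{A})$.
   Context: For $\mathbf a\in\mathbb{Z}^d$, $x^{\mathbf a}:=x_1^{a_1}\dotsb x_d^{a_d}$. Let $\mathbb{R}\mathbb{P}^{\mathcal{A}}$ be the real projective space with homogeneous coordinates indexed by $\mathcal{A}$, and let $X_{\mathcal{A},w}\subset\mathbb{R}\mathbb{P}^{\mathcal{A}}$ be the closure of the image of $\mathbb{R}_{>0}^d$ under $x\mapsto[w_{\mathbf a}x^{\mathbf a}\mid\mathbf a\in\mathcal{A}]$. A parametrization of $X_{\mathcal{A},w}$ is given by non-negative continuous functions $\{\beta_{\mathbf a}\mid\mathbf a\in\mathcal{A}\}$ on $\Delta$ (blending functions), with no common zero on $\Delta$, such that the image of $\Delta$ under $x\mapsto[\beta_{\mathbf a}(x)\mid\mathbf a\in\mathcal{A}]$ equals $X_{\mathcal{A},w}$;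 they are normalized if $\sum_{\mathbf a}\beta_{\mathbf a}(x)=1$ on $\Delta$. It has linear precision if, for the normalized functions, $\sum_{\mathbf a}\beta_{\mathbf a}(x)\,\mathbf a=x$ for all $x\in\Delta$. Such a parametrization exists and is unique: it is the inverse of the homeomorphism $X_{\mathcal{A},w}\to\Delta$, $[y_{\mathbf a}]\mapsto\bigl(\sum_{\mathbf a}y_{\mathbf a}\mathbf a\bigr)/\bigl(\sum_{\mathbf a}y_{\mathbf a}\bigr)$ (the tautological projection). Iterative proportional fitting. For $u\in\mathbb{R}^d$ write $|u|=u_1+\dotsb+u_d$. Homogenize the data: choose $\mathbf b\in\mathbb{R}^d$ and $t>0$ such that for all $\mathbf a\in\mathcal{A}$ the vector $t(\mathbf a+\mathbf b)$ has positive coordinates and $|t(\mathbf a+\mathbf b)|\le1$, and define the affine map $\psi\colon\mathbb{R}^d\to\mathbb{R}^{1+d}$ by $\psi(x)=(1-|t(x+\mathbf b)|,\;t(x+\mathbf b))$, so that $\psi(\mathcal{A})$ lies in the probability simplex $\{z\in\mathbb{R}^{1+d}_{\ge0}\mid z_0+\dotsb+z_d=1\}$. Given $y\in\Delta$, set $p^{(0)}_{\mathbf a}:=w_{\mathbf a}$ and, for $n\ge0$, $$p^{(n+1)}_{\mathbf a}:=p^{(n)}_{\mathbf a}\prod_{i=0}^{d}\left(\frac{\psi(y)_i}{m^{(n)}_i}\right)^{\psi(\mathbf a)_i},\qquad m^{(n)}:=\sum_{\mathbf c\in\mathcal{A}}p^{(n)}_{\mathbf c}\,\psi(\mathbf c)\in\mathbb{R}^{1+d},$$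 with the conventions that a factor with exponent $\psi(\mathbf a)_i=0$ equals $1$ and that $p^{(n+1)}_{\mathbf a}=0$ whenever $p^{(n)}_{\mathbf a}=0$. Set $\mathbf p^{(n)}=(p^{(n)}_{\mathbf a}\mid\mathbf a\in\mathcal{A})\in\mathbb{R}^{\mathcal{A}}_{\geq 0}$. *)

theory Defs
  imports "HOL-Analysis.Analysis"
begin

section \<open>Real projective space with homogeneous coordinates indexed by a set\<close>

text \<open>Coordinate vectors in \<open>\<real>\<^sup>A\<close> are functions that are \<^term>\<open>undefined\<close> outside \<open>A\<close>, as in the
  carrier of \<^const>\<open>product_topology\<close>. A point of projective space is the set of all its
  homogeneous coordinate vectors, i.e. a line through the origin without the origin.\<close>

definition homog_coords :: "'a set \<Rightarrow> ('a \<Rightarrow> real) set" where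
  "homog_coords A = {y \<in> A \<rightarrow>\<^sub>E UNIV. \<exists>a\<in>A. y a \<noteq> 0}"

definition proj_point :: "'a set \<Rightarrow> ('a \<Rightarrow> real) \<Rightarrow> ('a \<Rightarrow> real) set" where
  "proj_point A y = {restrict (\<lambda>a. c * y a) A | c. c \<noteq> 0}"

definition proj_space :: "'a set \<Rightarrow> ('a \<Rightarrow> real) set set" where
  "proj_space A = proj_point A ` homog_coords A"

definition homog_topology :: "'a set \<Rightarrow> ('a \<Rightarrow> real) topology" where
  "homog_topology A = subtopology (product_topology (\<lambda>_. euclideanreal) A) (homog_coords A)"

text \<open>The quotient topology; see \<open>quotient_map_proj_point\<close> below.\<close>

definition proj_topology :: "'a set \<Rightarrow> ('a \<Rightarrow> real) set topology" where
  "proj_topology A = topology (\<lambda>U. U \<subseteq> proj_space A \<and>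
     openin (homog_topology A) {y \<in> homog_coords A. proj_point A y \<in> U})"

lemma topspace_homog_topology [simp]: "topspace (homog_topology A) = homog_coords A"
  by (auto simp: homog_topology_def homog_coords_def)

lemma openin_proj_topology:
  "openin (proj_topology A) U \<longleftrightarrow> U \<subseteq> proj_space A \<and>
     openin (homog_topology A) {y \<in> homog_coords A. proj_point A y \<in> U}"
proof -
  have "istopology (\<lambda>U. U \<subseteq> proj_space A \<and>
      openin (homog_topology A) {y \<in> homog_coords A. proj_point A y \<in> U})"
    unfolding istopology_def
  proof (rule conjI; intro allI impI conjI)
    fix S T
    assume S: "S \<subseteq> proj_space A \<and> openin (homog_topology A) {y \<in> homog_coords A. proj_point A y \<in> S}"
      and T: "T \<subseteq> proj_space A \<and> openin (homog_topology A) {y \<in> homog_coords A. proj_point A y \<in> T}"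
    show "S \<inter> T \<subseteq> proj_space A"
      using S by blast
    have "{y \<in> homog_coords A. proj_point A y \<in> S \<inter> T} =
        {y \<in> homog_coords A. proj_point A y \<in> S} \<inter> {y \<in> homog_coords A. proj_point A y \<in> T}"
      by blast
    then show "openin (homog_topology A) {y \<in> homog_coords A. proj_point A y \<in> S \<inter> T}"
      using S T by (simp add: openin_Int)
  next
    fix \<K>
    assume K: "\<forall>K\<in>\<K>. K \<subseteq> proj_space A \<and>
      openin (homog_topology A) {y \<in> homog_coords A. proj_point A y \<in> K}"
    show "\<Union>\<K> \<subseteq> proj_space A"
      using K by blast
    have "{y \<in> homog_coords A. proj_point A y \<in> \<Union>\<K>} =
        (\<Union>K\<in>\<K>. {y \<in> homog_coords A. proj_point A y \<in> K})"
      by blast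
    then show "openin (homog_topology A) {y \<in> homog_coords A. proj_point A y \<in> \<Union>\<K>}"
      using K by (simp add: openin_clauses(3))
  qed
  then show ?thesis
    by (simp add: proj_topology_def)
qed

lemma topspace_proj_topology [simp]: "topspace (proj_topology A) = proj_space A"
proof -
  have "{y \<in> homog_coords A. proj_point A y \<in> proj_space A} = homog_coords A"
    by (auto simp: proj_space_def)
  then have "openin (proj_topology A) (proj_space A)"
    using openin_topspace[of "homog_topology A"] by (simp add: openin_proj_topology)
  moreover have "topspace (proj_topology A) \<subseteq> proj_space A"
    using openin_topspace[of "proj_topology A"] by (simp only: openin_proj_topology)
  ultimately show ?thesis
    using openin_subset by blast
qed

lemma quotient_map_proj_point:
  "quotient_map (homog_topology A) (proj_topology A) (proj_point A)"
  by (auto simp: quotient_map_def openin_proj_topology proj_space_def)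

section \<open>Toric patches and their parametrizations\<close>

definition of_int_vec :: "int ^ 'd \<Rightarrow> real ^ 'd" where
  "of_int_vec a = (\<chi> i. of_int (a $ i))"

definition monomial :: "real ^ 'd \<Rightarrow> int ^ 'd \<Rightarrow> real" where
  "monomial x a = (\<Prod>i\<in>UNIV. (x $ i) powi (a $ i))"

definition polytope_of :: "(int ^ 'd) set \<Rightarrow> (real ^ 'd) set" where
  "polytope_of A = convex hull (of_int_vec ` A)"

definition toric_patch :: "(int ^ 'd) set \<Rightarrow> (int ^ 'd \<Rightarrow> real) \<Rightarrow> (int ^ 'd \<Rightarrow> real) set set" where
  "toric_patch A w = proj_topology A closure_of
     ((\<lambda>x. proj_point A (\<lambda>a. w a * monomial x a)) ` {x. \<forall>i. x $ i > 0})"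

definition blending_functions :: "(int ^ 'd) set \<Rightarrow> (int ^ 'd \<Rightarrow> real ^ 'd \<Rightarrow> real) \<Rightarrow> bool" where
  "blending_functions A \<beta> \<longleftrightarrow>
     (\<forall>a\<in>A. continuous_on (polytope_of A) (\<beta> a) \<and> (\<forall>x\<in>polytope_of A. \<beta> a x \<ge> 0)) \<and>
     (\<forall>x\<in>polytope_of A. \<exists>a\<in>A. \<beta> a x \<noteq> 0)"

definition parametrization ::
  "(int ^ 'd) set \<Rightarrow> (int ^ 'd \<Rightarrow> real) \<Rightarrow> (int ^ 'd \<Rightarrow> real ^ 'd \<Rightarrow> real) \<Rightarrow> bool" where
  "parametrization A w \<beta> \<longleftrightarrow> blending_functions A \<beta> \<and>
     (\<lambda>x. proj_point A (\<lambda>a. \<beta> a x)) ` polytope_of A = toric_patch A w"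

definition normalized :: "(int ^ 'd) set \<Rightarrow> (int ^ 'd \<Rightarrow> real ^ 'd \<Rightarrow> real) \<Rightarrow> bool" where
  "normalized A \<beta> \<longleftrightarrow> (\<forall>x\<in>polytope_of A. (\<Sum>a\<in>A. \<beta> a x) = 1)"

definition normalization ::
  "(int ^ 'd) set \<Rightarrow> (int ^ 'd \<Rightarrow> real ^ 'd \<Rightarrow> real) \<Rightarrow> int ^ 'd \<Rightarrow> real ^ 'd \<Rightarrow> real" where
  "normalization A \<beta> a x = \<beta> a x / (\<Sum>c\<in>A. \<beta> c x)"

definition linear_precision :: "(int ^ 'd) set \<Rightarrow> (int ^ 'd \<Rightarrow> real ^ 'd \<Rightarrow> real) \<Rightarrow> bool" where
  "linear_precision A \<beta> \<longleftrightarrow>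
     (\<forall>x\<in>polytope_of A. (\<Sum>a\<in>A. normalization A \<beta> a x *\<^sub>R of_int_vec a) = x)"

section \<open>Iterative proportional fitting\<close>

definition coord_sum :: "real ^ 'd \<Rightarrow> real" where
  "coord_sum u = (\<Sum>i\<in>UNIV. u $ i)"

definition homogenizing :: "(int ^ 'd) set \<Rightarrow> real ^ 'd \<Rightarrow> real \<Rightarrow> bool" where
  "homogenizing A b t \<longleftrightarrow> t > 0 \<and>
     (\<forall>a\<in>A. (\<forall>i. (t *\<^sub>R (of_int_vec a + b)) $ i > 0) \<and> coord_sum (t *\<^sub>R (of_int_vec a + b)) \<le> 1)"

text \<open>The index set \<open>{0, \<dots>, d}\<close> of \<open>\<real>\<^sup>1\<^sup>+\<^sup>d\<close> is rendered by \<open>'d option\<close>, with \<^const>\<open>None\<close> in the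
  role of \<open>0\<close>.\<close>

definition homogenize :: "real ^ 'd \<Rightarrow> real \<Rightarrow> real ^ 'd \<Rightarrow> real ^ 'd option" where
  "homogenize b t x =
     (\<chi> i. case i of None \<Rightarrow> 1 - coord_sum (t *\<^sub>R (x + b)) | Some j \<Rightarrow> (t *\<^sub>R (x + b)) $ j)"

text \<open>Factors with exponent \<open>0\<close> are treated separately because \<open>0 powr 0 = 0\<close>. Entries that are
  \<open>0\<close> stay \<open>0\<close>, whatever the value of the factors (which may involve a division by \<open>0\<close>).\<close>

primrec ipf :: "(int ^ 'd) set \<Rightarrow> (int ^ 'd \<Rightarrow> real) \<Rightarrow> real ^ 'd \<Rightarrow> real \<Rightarrow> real ^ 'd \<Rightarrow>
    nat \<Rightarrow> int ^ 'd \<Rightarrow> real" where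
  "ipf A w b t y 0 = w"
| "ipf A w b t y (Suc n) =
     (let p = ipf A w b t y n;
          m = (\<Sum>c\<in>A. p c *\<^sub>R homogenize b t (of_int_vec c))
      in (\<lambda>a. p a * (\<Prod>i\<in>UNIV. if homogenize b t (of_int_vec a) $ i = 0 then 1
                else (homogenize b t y $ i / m $ i) powr (homogenize b t (of_int_vec a) $ i))))"

end

theory Submission
  imports Defs
begin

text \<open>A log-affine function \<open>w \<cdot> exp f\<close> is orthogonal, through \<open>f\<close>, to the difference of two
  vectors with equal moments. Hence two limits \<open>p\<close>, \<open>q\<close> of log-affine functions with equal moments
  coincide: for close approximants \<open>w \<cdot> exp f\<close> of \<open>p\<close> and \<open>w \<cdot> exp g\<close> of \<open>q\<close>, all terms of
  \<open>\<Sum> (p - q) (f - g) = 0\<close> are nonnegative, and positive where \<open>p \<noteq> q\<close>. The gain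
  \<open>\<Sum> \<eta> ln (\<eta> / m)\<close> of one fitting step is the increase of the log-likelihood
  of any vector with moments \<open>\<eta>\<close>, which is bounded above; so the gain tends to \<open>0\<close> and the moments
  \<open>m\<close> tend to \<open>\<eta>\<close>. By uniqueness the iterates have a single limit point, which lies
  over the given point of the polytope. This also yields existence of the parametrization, and
  compactness yields its continuity.\<close>

section \<open>Limits of log-affine functions\<close>

text \<open>For finite \<open>A\<close>, the closure of a log-linear model with base weights
  \<open>w\<close>: boundary points with zero entries are included, and entries outside
  \<open>A\<close> are left free.\<close>

definition exp_closure :: "'a set \<Rightarrow> ('a \<Rightarrow> real) \<Rightarrow> ('a \<Rightarrow> real) set \<Rightarrow> ('a \<Rightarrow> real) set" where
  "exp_closure A w V = {p. \<forall>\<epsilon>>0. \<exists>f\<in>V. \<forall>a\<in>A. \<bar>p a - w a * exp (f a)\<bar> < \<epsilon>}"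

lemma exp_closureD:
  assumes "p \<in> exp_closure A w V" "\<epsilon> > 0"
  obtains f where "f \<in> V" "\<And>a. a \<in> A \<Longrightarrow> \<bar>p a - w a * exp (f a)\<bar> < \<epsilon>"
  using assms unfolding exp_closure_def by blast

lemma exp_closure_mono: "V \<subseteq> W \<Longrightarrow> exp_closure A w V \<subseteq> exp_closure A w W"
  by (fastforce simp: exp_closure_def)

lemma exp_closure_cong:
  "(\<And>a. a \<in> A \<Longrightarrow> p a = q a) \<Longrightarrow> p \<in> exp_closure A w V \<longleftrightarrow> q \<in> exp_closure A w V"
  by (simp add: exp_closure_def cong: ball_cong)

lemma exp_closure_nonneg:
  assumes "p \<in> exp_closure A w V" "a \<in> A" "w a \<ge> 0"
  shows "p a \<ge> 0"
proof (rule ccontr)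
  assume "\<not> p a \<ge> 0"
  then have "- p a > 0" by simp
  then obtain f where "\<bar>p a - w a * exp (f a)\<bar> < - p a"
    using exp_closureD[OF assms(1)] assms(2) by metis
  moreover have "w a * exp (f a) \<ge> 0" using assms(3) by simp
  ultimately show False by linarith
qed

text \<open>Finiteness of \<open>A\<close> lets one index \<open>n\<close> serve all coordinates.
  Used for limit points of the iterates and for continuity of the parametrization.\<close>

lemma exp_closure_limit:
  assumes A: "finite A" and p: "\<And>n::nat. p n \<in> exp_closure A w V"
    and lim: "\<And>a. a \<in> A \<Longrightarrow> (\<lambda>n. p n a) \<longlonglongrightarrow> l a"
  shows "l \<in> exp_closure A w V"
  unfolding exp_closure_def
proof (intro CollectI allI impI)
  fix \<epsilon> :: real assume e: "\<epsilon> > 0"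
  have "\<forall>\<^sub>F n in sequentially. \<bar>p n a - l a\<bar> < \<epsilon> / 2" if "a \<in> A" for a
    using tendstoD[OF lim[OF that], of "\<epsilon> / 2"] e by (simp add: dist_real_def)
  then have "\<forall>\<^sub>F n in sequentially. \<forall>a\<in>A. \<bar>p n a - l a\<bar> < \<epsilon> / 2"
    using A by (simp add: eventually_ball_finite)
  then obtain n where n: "\<And>a. a \<in> A \<Longrightarrow> \<bar>p n a - l a\<bar> < \<epsilon> / 2"
    using eventually_happens by fastforce
  obtain f where f: "f \<in> V" "\<And>a. a \<in> A \<Longrightarrow> \<bar>p n a - w a * exp (f a)\<bar> < \<epsilon> / 2"
    using exp_closureD[OF p, of "\<epsilon> / 2" n] e by auto
  have "\<bar>l a - w a * exp (f a)\<bar> < \<epsilon>" if "a \<in> A" for a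
    using n[OF that] f(2)[OF that] by linarith
  with f(1) show "\<exists>f\<in>V. \<forall>a\<in>A. \<bar>l a - w a * exp (f a)\<bar> < \<epsilon>" by blast
qed

text \<open>The factor \<open>c\<close> is absorbed into the exponent as the constant
  \<open>ln c\<close>; hence the stability of \<open>V\<close> under adding constants.\<close>

lemma exp_closure_scale:
  assumes p: "p \<in> exp_closure A w V" and c: "c > 0"
    and V: "\<And>f k. f \<in> V \<Longrightarrow> (\<lambda>a. k + f a) \<in> V"
  shows "(\<lambda>a. c * p a) \<in> exp_closure A w V"
  unfolding exp_closure_def
proof (intro CollectI allI impI)
  fix \<epsilon> :: real assume e: "\<epsilon> > 0"
  obtain f where f: "f \<in> V" "\<And>a. a \<in> A \<Longrightarrow> \<bar>p a - w a * exp (f a)\<bar> < \<epsilon> / c"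
    using exp_closureD[OF p, of "\<epsilon> / c"] e c by auto
  have "\<bar>c * p a - w a * exp (ln c + f a)\<bar> < \<epsilon>" if "a \<in> A" for a
  proof -
    have "c * p a - w a * exp (ln c + f a) = c * (p a - w a * exp (f a))"
      using c by (simp add: exp_add algebra_simps)
    then have "\<bar>c * p a - w a * exp (ln c + f a)\<bar> = c * \<bar>p a - w a * exp (f a)\<bar>"
      using c by (simp only: abs_mult abs_of_pos)
    also have "\<dots> < \<epsilon>" using f(2)[OF that] c by (simp add: pos_less_divide_eq mult.commute)
    finally show ?thesis .
  qed
  then show "\<exists>f\<in>V. \<forall>a\<in>A. \<bar>c * p a - w a * exp (f a)\<bar> < \<epsilon>"
    using V[OF f(1), of "ln c"] by (intro bexI[where x = "\<lambda>a. ln c + f a"]) auto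
qed

text \<open>The uniqueness half of Birch's theorem, by monotonicity of \<open>exp\<close>. Working
  with approximants covers boundary points, where logarithms of zero entries would be
  meaningless.\<close>

lemma exp_closure_unique:
  assumes A: "finite A" and w: "\<And>a. a \<in> A \<Longrightarrow> w a > 0"
    and p: "p \<in> exp_closure A w V" and q: "q \<in> exp_closure A w V"
    and eq: "\<And>f. f \<in> V \<Longrightarrow> (\<Sum>a\<in>A. p a * f a) = (\<Sum>a\<in>A. q a * f a)"
    and a: "a \<in> A"
  shows "p a = q a"
proof (rule ccontr)
  assume ne: "p a \<noteq> q a"
  define S where "S = (\<lambda>a. \<bar>p a - q a\<bar>) ` {a \<in> A. p a \<noteq> q a}"
  \<comment> \<open>Half the smallest nonzero gap: approximants closer than this are ordered as
    \<open>p\<close> and \<open>q\<close> are wherever these differ.\<close>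
  define \<epsilon> where "\<epsilon> = Min S / 2"
  have S: "finite S" "S \<noteq> {}" using A a ne unfolding S_def by auto
  have "\<epsilon> > 0" using S unfolding \<epsilon>_def by (auto simp: S_def)
  obtain f where f: "f \<in> V" "\<And>a. a \<in> A \<Longrightarrow> \<bar>p a - w a * exp (f a)\<bar> < \<epsilon>"
    using exp_closureD[OF p \<open>\<epsilon> > 0\<close>] by blast
  obtain g where g: "g \<in> V" "\<And>a. a \<in> A \<Longrightarrow> \<bar>q a - w a * exp (g a)\<bar> < \<epsilon>"
    using exp_closureD[OF q \<open>\<epsilon> > 0\<close>] by blast
  have pos: "(p c - q c) * (f c - g c) > 0" if c: "c \<in> A" "p c \<noteq> q c" for c
  proof -
    have "Min S \<le> \<bar>p c - q c\<bar>" using S c by (auto intro!: Min_le simp: S_def)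
    then have gap: "2 * \<epsilon> \<le> \<bar>p c - q c\<bar>" by (simp add: \<epsilon>_def)
    show ?thesis
    proof (cases "p c > q c")
      case True
      then have "w c * exp (f c) > w c * exp (g c)"
        using gap f(2)[OF c(1)] g(2)[OF c(1)] by linarith
      then show ?thesis using True w[OF c(1)] by simp
    next
      case False
      then have "w c * exp (f c) < w c * exp (g c)"
        using gap f(2)[OF c(1)] g(2)[OF c(1)] by linarith
      then show ?thesis using False w[OF c(1)] c(2) by (simp add: mult_neg_neg)
    qed
  qed
  have "(p c - q c) * (f c - g c) \<ge> 0" if "c \<in> A" for c
    using pos[OF that] by (cases "p c = q c") auto
  then have "(\<Sum>c\<in>A. (p c - q c) * (f c - g c)) > 0"
    using A a pos[OF a ne] by (intro sum_pos2[of A a]) auto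
  moreover have "(\<Sum>c\<in>A. (p c - q c) * (f c - g c)) = 0"
    using eq[OF f(1)] eq[OF g(1)] by (simp add: algebra_simps sum.distrib sum_subtractf)
  ultimately show False by simp
qed

section \<open>Sequential compactness in finitely many coordinates\<close>

lemma bounded_convergent_subsequence:
  fixes p :: "nat \<Rightarrow> 'a \<Rightarrow> real"
  assumes "finite A" and bd: "\<And>n a. a \<in> A \<Longrightarrow> \<bar>p n a\<bar> \<le> B"
  shows "\<exists>l r. strict_mono r \<and> (\<forall>a\<in>A. (\<lambda>n. p (r n) a) \<longlonglongrightarrow> l a)"
  using assms
proof (induction A rule: finite_induct)
  case empty
  show ?case using strict_mono_id by auto
next
  case (insert x A)
  then obtain l r where r: "strict_mono (r :: nat \<Rightarrow> nat)" "\<forall>a\<in>A. (\<lambda>n. p (r n) a) \<longlonglongrightarrow> l a"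
    by auto
  have "\<forall>n. p (r n) x \<in> {-B..B}" using insert.prems[of x] by (auto simp: abs_le_iff minus_le_iff)
  then obtain k s where s: "strict_mono (s :: nat \<Rightarrow> nat)" "((\<lambda>n. p (r n) x) \<circ> s) \<longlonglongrightarrow> k"
    using compact_imp_seq_compact[OF compact_Icc[of "-B" B]] unfolding seq_compact_def by metis
  have "(\<lambda>n. p (r (s n)) a) \<longlonglongrightarrow> (l(x := k)) a" if "a \<in> insert x A" for a
  proof (cases "a = x")
    case True
    then show ?thesis using s(2) by (simp add: o_def)
  next
    case False
    then have "(\<lambda>n. p (r n) a) \<longlonglongrightarrow> l a" using r(2) that by simp
    from LIMSEQ_subseq_LIMSEQ[OF this s(1)] show ?thesis using False by (simp add: o_def)
  qed
  then show ?case
    using strict_mono_o[OF r(1) s(1)] by (intro exI[of _ "l(x := k)"] exI[of _ "r \<circ> s"]) (simp add: o_def)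
qed

text \<open>If coordinate \<open>a\<close> did not converge, infinitely many indices would stay
  \<open>e\<close> away from \<open>l a\<close>; a convergent subsequence of these would have a
  limit different from \<open>l\<close> at \<open>a\<close>.\<close>

lemma convergent_if_unique_limit_point:
  fixes p :: "nat \<Rightarrow> 'a \<Rightarrow> real"
  assumes A: "finite A" and bd: "\<And>n a. a \<in> A \<Longrightarrow> \<bar>p n a\<bar> \<le> B"
    and uniq: "\<And>l' r a. strict_mono r \<Longrightarrow> (\<And>a. a \<in> A \<Longrightarrow> (\<lambda>n. p (r n) a) \<longlonglongrightarrow> l' a) \<Longrightarrow>
      a \<in> A \<Longrightarrow> l' a = l a"
    and a: "a \<in> A"
  shows "(\<lambda>n. p n a) \<longlonglongrightarrow> l a"
proof (rule ccontr)
  assume "\<not> ?thesis"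
  then obtain e where e: "e > 0" "\<not> (\<forall>\<^sub>F n in sequentially. dist (p n a) (l a) < e)"
    unfolding tendsto_iff by blast
  then have "infinite {n. \<not> dist (p n a) (l a) < e}"
    by (simp add: frequently_cofinite[symmetric] cofinite_eq_sequentially not_eventually)
  from infinite_enumerate[OF this]
  obtain r where r: "strict_mono (r :: nat \<Rightarrow> nat)" "\<And>n. \<not> dist (p (r n) a) (l a) < e"
    by auto
  obtain l' s where s: "strict_mono s" "\<forall>a\<in>A. (\<lambda>n. p (r (s n)) a) \<longlonglongrightarrow> l' a"
    using bounded_convergent_subsequence[OF A, of "\<lambda>n. p (r n)" B] bd by blast
  have "l' a = l a"
    using uniq[OF strict_mono_o[OF r(1) s(1)], of l' a] s(2) a by simp
  then have "(\<lambda>n. p (r (s n)) a) \<longlonglongrightarrow> l a" using s(2)[rule_format, OF a] by simp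
  from tendstoD[OF this e(1)] show False
    using r(2) by (simp add: eventually_sequentially)
qed

section \<open>Iterative scaling\<close>

text \<open>Generalized iterative scaling in the sense of Darroch and Ratcliff. The probability
  vector \<open>q\<close> witnesses that the target moments \<open>\<eta>\<close> are attainable;
  the recursion itself sees only \<open>\<eta>\<close>.\<close>

locale iterative_scaling =
  fixes A :: "'a set" and w :: "'a \<Rightarrow> real" and \<psi> :: "'a \<Rightarrow> 'i::finite \<Rightarrow> real"
    and q :: "'a \<Rightarrow> real" and \<eta> :: "'i \<Rightarrow> real"
    and P :: "nat \<Rightarrow> 'a \<Rightarrow> real" and m :: "nat \<Rightarrow> 'i \<Rightarrow> real"
  assumes finite_A: "finite A"
    and w_pos: "\<And>a. a \<in> A \<Longrightarrow> w a > 0"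
    and \<psi>_nonneg: "\<And>a i. a \<in> A \<Longrightarrow> \<psi> a i \<ge> 0"
    and \<psi>_sum: "\<And>a. a \<in> A \<Longrightarrow> (\<Sum>i\<in>UNIV. \<psi> a i) = 1"
    and q_nonneg: "\<And>a. a \<in> A \<Longrightarrow> q a \<ge> 0"
    and q_sum: "(\<Sum>a\<in>A. q a) = 1"
    and \<eta>_eq: "\<And>i. \<eta> i = (\<Sum>a\<in>A. q a * \<psi> a i)"
    and P_0: "\<And>a. a \<in> A \<Longrightarrow> P 0 a = w a"
    and P_Suc: "\<And>n a. a \<in> A \<Longrightarrow> P (Suc n) a =
      P n a * (\<Prod>i\<in>UNIV. if \<psi> a i = 0 then 1 else (\<eta> i / m n i) powr \<psi> a i)"
    and m_eq: "\<And>n i. m n i = (\<Sum>a\<in>A. P n a * \<psi> a i)"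
begin

text \<open>The face of \<open>A\<close> that carries every nonnegative vector with moments \<open>\<eta>\<close>.\<close>

definition face :: "'a set" where
  "face = {a \<in> A. \<forall>i. \<eta> i = 0 \<longrightarrow> \<psi> a i = 0}"

definition features :: "('a \<Rightarrow> real) set" where
  "features = range (\<lambda>\<theta> a. \<Sum>i\<in>UNIV. \<theta> i * \<psi> a i)"

lemma face_subset: "face \<subseteq> A"
  by (auto simp: face_def)

lemma \<eta>_nonneg: "\<eta> i \<ge> 0"
  unfolding \<eta>_eq by (intro sum_nonneg mult_nonneg_nonneg q_nonneg \<psi>_nonneg)

lemma \<eta>_sum: "(\<Sum>i\<in>UNIV. \<eta> i) = 1"
proof -
  have "(\<Sum>i\<in>UNIV. \<eta> i) = (\<Sum>a\<in>A. q a * (\<Sum>i\<in>UNIV. \<psi> a i))"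
    unfolding \<eta>_eq sum_distrib_left by (rule sum.swap)
  then show ?thesis using \<psi>_sum q_sum by simp
qed

text \<open>A vanishing moment \<open>\<eta> i\<close> is a sum of nonnegative terms, so each term
  \<open>q a * \<psi> a i\<close> vanishes.\<close>

lemma q_pos_face:
  assumes "a \<in> A" "q a > 0"
  shows "a \<in> face"
proof -
  have "\<psi> a i = 0" if "\<eta> i = 0" for i
  proof -
    have "q a * \<psi> a i = 0"
      using that assms(1) finite_A sum_nonneg_eq_0_iff[of A "\<lambda>a. q a * \<psi> a i"] q_nonneg \<psi>_nonneg
      unfolding \<eta>_eq by simp
    then show ?thesis using assms(2) by simp
  qed
  then show ?thesis using assms(1) by (simp add: face_def)
qed

section \<open>Support and log-affine form of the iterates\<close>

lemma P_nonneg: "a \<in> A \<Longrightarrow> P n a \<ge> 0"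
  by (induction n) (auto simp: P_0 P_Suc less_imp_le[OF w_pos] intro!: mult_nonneg_nonneg prod_nonneg)

lemma m_nonneg: "m n i \<ge> 0"
  unfolding m_eq by (intro sum_nonneg mult_nonneg_nonneg P_nonneg \<psi>_nonneg)

text \<open>A positive \<open>\<eta> i\<close> has a contributing \<open>a\<close> with
  \<open>q a > 0\<close>, which lies in the face and so carries mass of \<open>P n\<close>.
  Positivity on the face is a hypothesis because the induction in \<open>P_face_exp\<close> needs
  this before \<open>P_face_pos\<close> is available.\<close>

lemma m_pos_if:
  assumes P: "\<And>a. a \<in> face \<Longrightarrow> P n a > 0" and i: "\<eta> i > 0"
  shows "m n i > 0"
proof -
  have "\<not> (\<forall>a\<in>A. q a * \<psi> a i \<le> 0)"
    using i sum_nonpos[of A "\<lambda>a. q a * \<psi> a i"] unfolding \<eta>_eq by auto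
  then obtain a where a: "a \<in> A" "q a * \<psi> a i > 0"
    by (auto simp: not_le)
  then have "q a > 0" "\<psi> a i > 0"
    using q_nonneg[OF a(1)] \<psi>_nonneg[OF a(1), of i] by (auto simp: zero_less_mult_iff)
  then have "P n a * \<psi> a i > 0"
    using P q_pos_face[OF a(1)] by simp
  then show ?thesis
    unfolding m_eq using a(1) finite_A P_nonneg \<psi>_nonneg by (intro sum_pos2[of A a]) auto
qed

text \<open>On the face a coordinate with \<open>\<eta> i = 0\<close> has exponent 0, so the
  meaningless logarithm there is multiplied by 0.\<close>

lemma P_Suc_face:
  assumes a: "a \<in> face" and m: "\<And>i. \<eta> i > 0 \<Longrightarrow> m n i > 0"
  shows "P (Suc n) a = P n a * exp (\<Sum>i\<in>UNIV. \<psi> a i * ln (\<eta> i / m n i))"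
proof -
  have "(if \<psi> a i = 0 then 1 else (\<eta> i / m n i) powr \<psi> a i) = exp (\<psi> a i * ln (\<eta> i / m n i))" for i
  proof (cases "\<eta> i = 0")
    case True
    then show ?thesis using a by (simp add: face_def)
  next
    case False
    then have "\<eta> i > 0" using \<eta>_nonneg[of i] by simp
    then show ?thesis using m[of i] by (simp add: powr_def)
  qed
  then show ?thesis using a face_subset by (simp add: P_Suc exp_sum subset_iff)
qed

lemma P_face_exp: "\<exists>\<theta>. \<forall>a\<in>face. P n a = w a * exp (\<Sum>i\<in>UNIV. \<theta> i * \<psi> a i)"
proof (induction n)
  case 0
  show ?case using face_subset by (intro exI[of _ "\<lambda>_. 0"]) (auto simp: P_0)
next
  case (Suc n)
  then obtain \<theta> where \<theta>: "\<forall>a\<in>face. P n a = w a * exp (\<Sum>i\<in>UNIV. \<theta> i * \<psi> a i)" by blast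
  have m: "\<eta> i > 0 \<Longrightarrow> m n i > 0" for i
    using \<theta> face_subset by (intro m_pos_if) (auto intro!: mult_pos_pos w_pos)
  \<comment> \<open>The multipliers accumulate the logarithms of the correction factors.\<close>
  have "P (Suc n) a = w a * exp (\<Sum>i\<in>UNIV. (\<theta> i + ln (\<eta> i / m n i)) * \<psi> a i)" if a: "a \<in> face" for a
    using \<theta> a P_Suc_face[OF a m] by (simp add: algebra_simps sum.distrib exp_add)
  then show ?case by (intro exI[of _ "\<lambda>i. \<theta> i + ln (\<eta> i / m n i)"]) simp
qed

lemma P_face_pos: "a \<in> face \<Longrightarrow> P n a > 0"
  using P_face_exp[of n] face_subset by (auto intro!: mult_pos_pos w_pos)

lemma m_pos: "\<eta> i > 0 \<Longrightarrow> m n i > 0"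
  by (intro m_pos_if P_face_pos)

lemma P_off_face:
  assumes "a \<in> A" "a \<notin> face"
  shows "P (Suc n) a = 0"
proof -
  obtain i where "\<eta> i = 0" "\<psi> a i \<noteq> 0" using assms by (auto simp: face_def)
  \<comment> \<open>The factor at this \<open>i\<close> is \<open>0 powr \<psi> a i = 0\<close>,
    even if \<open>m n i = 0\<close>, since division by 0 yields 0.\<close>
  then have "(\<Prod>i\<in>UNIV. if \<psi> a i = 0 then 1 else (\<eta> i / m n i) powr \<psi> a i) = 0"
    by (auto intro!: bexI[of _ i])
  then show ?thesis using assms by (simp add: P_Suc)
qed

text \<open>Weighted AM-GM, as Jensen's inequality for \<open>exp\<close> with weights
  \<open>\<psi> a i\<close>, bounds each correction factor by a mean of the ratios
  \<open>\<eta> i / m n i\<close>. Summing over \<open>a\<close> cancels the moments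
  \<open>m n i\<close> and leaves the sum of \<open>\<eta>\<close>. The index starts at 1 because
  the weights \<open>w\<close> may have any mass.\<close>

lemma P_sum_le: "(\<Sum>a\<in>A. P (Suc n) a) \<le> 1"
proof -
  \<comment> \<open>On these coordinates the ratios are positive, so that \<open>exp\<close> undoes
    \<open>ln\<close>; on the face the others have weight 0.\<close>
  define I where "I = {i. \<eta> i > 0}"
  have I: "finite I" "\<And>i. i \<notin> I \<Longrightarrow> \<eta> i = 0"
    using \<eta>_nonneg by (auto simp: I_def less_le)
  have le: "P (Suc n) a \<le> (\<Sum>i\<in>I. P n a * \<psi> a i * (\<eta> i / m n i))" if a: "a \<in> face" for a
  proof -
    have aA: "a \<in> A" using a face_subset by blast
    have \<psi>0: "\<psi> a i = 0" if "i \<notin> I" for i using I(2)[OF that] a by (simp add: face_def)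
    have sub: "(\<Sum>i\<in>I. \<psi> a i * g i) = (\<Sum>i\<in>UNIV. \<psi> a i * g i)" for g
      using \<psi>0 by (intro sum.mono_neutral_left) auto
    have one: "(\<Sum>i\<in>I. \<psi> a i) = 1"
      using sub[of "\<lambda>_. 1"] \<psi>_sum[OF aA] by simp
    have "exp (\<Sum>i\<in>UNIV. \<psi> a i * ln (\<eta> i / m n i)) = exp (\<Sum>i\<in>I. \<psi> a i *\<^sub>R ln (\<eta> i / m n i))"
      using sub by simp
    also have "\<dots> \<le> (\<Sum>i\<in>I. \<psi> a i * exp (ln (\<eta> i / m n i)))"
      using one I(1) \<psi>_nonneg[OF aA] by (intro convex_on_sum[OF _ _ exp_convex]) auto
    also have "\<dots> = (\<Sum>i\<in>I. \<psi> a i * (\<eta> i / m n i))"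
      using m_pos by (intro sum.cong) (auto simp: I_def)
    finally have "P n a * exp (\<Sum>i\<in>UNIV. \<psi> a i * ln (\<eta> i / m n i)) \<le> P n a * (\<Sum>i\<in>I. \<psi> a i * (\<eta> i / m n i))"
      using P_nonneg[OF aA] by (intro mult_left_mono)
    then show ?thesis using P_Suc_face[OF a m_pos] by (simp add: sum_distrib_left mult.assoc)
  qed
  have "(\<Sum>a\<in>A. P (Suc n) a) \<le> (\<Sum>a\<in>A. \<Sum>i\<in>I. P n a * \<psi> a i * (\<eta> i / m n i))"
  proof (intro sum_mono)
    fix a assume a: "a \<in> A"
    have "0 \<le> (\<Sum>i\<in>I. P n a * \<psi> a i * (\<eta> i / m n i))"
      using a by (intro sum_nonneg mult_nonneg_nonneg divide_nonneg_nonneg P_nonneg \<psi>_nonneg m_nonneg \<eta>_nonneg)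
    then show "P (Suc n) a \<le> (\<Sum>i\<in>I. P n a * \<psi> a i * (\<eta> i / m n i))"
      using le[of a] P_off_face[OF a] by (cases "a \<in> face") auto
  qed
  also have "\<dots> = (\<Sum>i\<in>I. m n i * (\<eta> i / m n i))"
    unfolding m_eq sum_distrib_right by (rule sum.swap)
  also have "\<dots> = (\<Sum>i\<in>I. \<eta> i)"
  proof (intro sum.cong refl)
    fix i assume "i \<in> I"
    then have "m n i > 0" by (simp add: I_def m_pos)
    then show "m n i * (\<eta> i / m n i) = \<eta> i" by simp
  qed
  also have "\<dots> = (\<Sum>i\<in>UNIV. \<eta> i)"
    using I(2) by (intro sum.mono_neutral_left) auto
  finally show ?thesis using \<eta>_sum by simp
qed

lemma P_le_1: "a \<in> A \<Longrightarrow> P (Suc n) a \<le> 1"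
  using P_sum_le[of n] member_le_sum[of a A "P (Suc n)"] finite_A P_nonneg by fastforce

lemma m_sum_le: "(\<Sum>i\<in>UNIV. m (Suc n) i) \<le> 1"
proof -
  have "(\<Sum>i\<in>UNIV. m (Suc n) i) = (\<Sum>a\<in>A. P (Suc n) a * (\<Sum>i\<in>UNIV. \<psi> a i))"
    unfolding m_eq sum_distrib_left by (rule sum.swap)
  then show ?thesis using \<psi>_sum P_sum_le by simp
qed

section \<open>The divergence of \<open>\<eta>\<close> from the moments, and convergence of the
  moments\<close>

definition gain :: "nat \<Rightarrow> real" where
  "gain n = (\<Sum>i\<in>UNIV. \<eta> i * ln (\<eta> i / m n i))"

lemma gain_eq: "gain n = (\<Sum>a\<in>A. q a * ln (P (Suc n) a)) - (\<Sum>a\<in>A. q a * ln (P n a))"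
proof -
  have *: "q a * (ln (P (Suc n) a) - ln (P n a)) = (\<Sum>i\<in>UNIV. q a * \<psi> a i * ln (\<eta> i / m n i))"
    if a: "a \<in> A" for a
  \<comment> \<open>For \<open>q a = 0\<close> both sides vanish, whatever value \<open>ln\<close>
    takes; otherwise \<open>a\<close> is in the face and the logarithms are genuine.\<close>
  proof (cases "q a = 0")
    case False
    then have "a \<in> face" using q_pos_face[OF a] q_nonneg[OF a] by simp
    then have "ln (P (Suc n) a) - ln (P n a) = (\<Sum>i\<in>UNIV. \<psi> a i * ln (\<eta> i / m n i))"
      using P_Suc_face[OF _ m_pos] P_face_pos[of a n] by (simp add: ln_mult)
    then show ?thesis by (simp add: sum_distrib_left mult.assoc)
  qed simp
  have "(\<Sum>a\<in>A. q a * ln (P (Suc n) a)) - (\<Sum>a\<in>A. q a * ln (P n a)) =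
      (\<Sum>a\<in>A. q a * (ln (P (Suc n) a) - ln (P n a)))"
    by (simp add: sum_subtractf right_diff_distrib)
  also have "\<dots> = (\<Sum>a\<in>A. \<Sum>i\<in>UNIV. q a * \<psi> a i * ln (\<eta> i / m n i))"
    by (intro sum.cong refl *)
  also have "\<dots> = (\<Sum>i\<in>UNIV. \<Sum>a\<in>A. q a * \<psi> a i * ln (\<eta> i / m n i))" by (rule sum.swap)
  also have "\<dots> = (\<Sum>i\<in>UNIV. (\<Sum>a\<in>A. q a * \<psi> a i) * ln (\<eta> i / m n i))"
    by (simp only: sum_distrib_right)
  also have "\<dots> = gain n" by (simp only: gain_def \<eta>_eq[symmetric])
  finally show ?thesis by simp
qed

text \<open>The squared Hellinger distance bounds the Kullback-Leibler divergence from below, by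
  \<open>ln u \<le> u - 1\<close> at \<open>u = sqrt (m / \<eta>)\<close>. The termwise correction
  \<open>m - \<eta>\<close> has nonpositive sum, since from index 1 on \<open>m\<close> has mass at
  most 1.\<close>

lemma gain_ge: "(\<Sum>i\<in>UNIV. (sqrt (\<eta> i) - sqrt (m (Suc n) i))\<^sup>2) \<le> gain (Suc n)"
proof -
  have *: "(sqrt (\<eta> i) - sqrt (m (Suc n) i))\<^sup>2 \<le>
      \<eta> i * ln (\<eta> i / m (Suc n) i) + (m (Suc n) i - \<eta> i)" for i
  proof (cases "\<eta> i = 0")
    case True
    then show ?thesis using m_nonneg by simp
  next
    case False
    then have h: "\<eta> i > 0" using \<eta>_nonneg[of i] by simp
    define x where "x = sqrt (\<eta> i)"
    define z where "z = sqrt (m (Suc n) i)"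
    have xz: "x > 0" "z > 0" "\<eta> i = x\<^sup>2" "m (Suc n) i = z\<^sup>2"
      using h m_pos[OF h, of "Suc n"] by (auto simp: x_def z_def)
    have "ln (z / x) \<le> z / x - 1" using xz by (intro ln_le_minus_one) simp
    then have "2 * x\<^sup>2 * ln (z / x) \<le> 2 * x\<^sup>2 * (z / x - 1)" by (intro mult_left_mono) auto
    moreover have "2 * x\<^sup>2 * (z / x - 1) = 2 * (x * z) - 2 * x\<^sup>2"
      using xz by (simp add: field_simps power2_eq_square)
    moreover have "ln (x\<^sup>2 / z\<^sup>2) = - 2 * ln (z / x)"
      using xz by (simp add: ln_div ln_realpow)
    ultimately have "2 * x\<^sup>2 * ln (z / x) \<le> 2 * (x * z) - 2 * x\<^sup>2" "ln (x\<^sup>2 / z\<^sup>2) = - 2 * ln (z / x)"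
      by simp_all
    then have "(x - z)\<^sup>2 \<le> x\<^sup>2 * ln (x\<^sup>2 / z\<^sup>2) + (z\<^sup>2 - x\<^sup>2)"
      by (simp add: power2_diff algebra_simps)
    then show ?thesis
      unfolding x_def[symmetric] z_def[symmetric] unfolding xz(3,4) .
  qed
  have "(\<Sum>i\<in>UNIV. (sqrt (\<eta> i) - sqrt (m (Suc n) i))\<^sup>2) \<le>
      (\<Sum>i\<in>UNIV. \<eta> i * ln (\<eta> i / m (Suc n) i) + (m (Suc n) i - \<eta> i))"
    by (intro sum_mono *)
  also have "\<dots> = gain (Suc n) + ((\<Sum>i\<in>UNIV. m (Suc n) i) - 1)"
    using \<eta>_sum by (simp add: gain_def sum.distrib sum_subtractf)
  finally show ?thesis using m_sum_le[of n] by simp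
qed

lemma gain_tendsto_0: "(\<lambda>n. gain (Suc n)) \<longlonglongrightarrow> 0"
proof -
  \<comment> \<open>The log-likelihood, shifted by one because only from index 1 on all entries are
    at most 1, which makes it nonpositive. Being monotone and bounded it converges, so its
    increments tend to 0.\<close>
  define L where "L n = (\<Sum>a\<in>A. q a * ln (P (Suc n) a))" for n
  have gain: "gain (Suc n) = L (Suc n) - L n" for n
    by (simp add: gain_eq L_def)
  have "gain (Suc n) \<ge> 0" for n
    by (rule order_trans[OF _ gain_ge]) (simp add: sum_nonneg)
  then have "incseq L" by (intro incseq_SucI) (simp add: gain)
  moreover have "L n \<le> 0" for n
    unfolding L_def
  proof (intro sum_nonpos)
    fix a assume a: "a \<in> A"
    have "ln (P (Suc n) a) \<le> 0"
      \<comment> \<open>The case of a zero entry relies on \<open>ln 0 = 0\<close>.\<close>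
      using P_le_1[OF a, of n] P_nonneg[OF a, of "Suc n"] by (cases "P (Suc n) a = 0") auto
    then show "q a * ln (P (Suc n) a) \<le> 0"
      using q_nonneg[OF a] by (simp add: mult_nonneg_nonpos)
  qed
  ultimately obtain c where c: "L \<longlonglongrightarrow> c" using incseq_convergent[of L 0] by blast
  have "(\<lambda>n. L (Suc n) - L n) \<longlonglongrightarrow> c - c" by (intro tendsto_diff LIMSEQ_Suc c)
  then show ?thesis by (simp add: gain)
qed

lemma m_tendsto: "(\<lambda>n. m (Suc n) i) \<longlonglongrightarrow> \<eta> i"
proof -
  have "(sqrt (\<eta> i) - sqrt (m (Suc n) i))\<^sup>2 \<le> gain (Suc n)" for n
    by (rule order_trans[OF _ gain_ge], rule member_le_sum) auto
  then have "(\<lambda>n. (sqrt (\<eta> i) - sqrt (m (Suc n) i))\<^sup>2) \<longlonglongrightarrow> 0"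
    by (intro tendsto_sandwich[OF _ _ tendsto_const gain_tendsto_0]) auto
  then have "(\<lambda>n. sqrt (\<eta> i) - (sqrt (\<eta> i) - sqrt (m (Suc n) i))) \<longlonglongrightarrow> sqrt (\<eta> i) - 0"
    by (intro tendsto_diff tendsto_const) (simp add: power_tendsto_0_iff)
  then have "(\<lambda>n. (sqrt (m (Suc n) i))\<^sup>2) \<longlonglongrightarrow> (sqrt (\<eta> i))\<^sup>2"
    by (intro tendsto_power) simp
  then show ?thesis using m_nonneg \<eta>_nonneg by simp
qed

text \<open>On the face the iterate is log-affine already. Lowering the multipliers of all
  \<open>i\<close> with \<open>\<eta> i = 0\<close> by a large \<open>N\<close> changes nothing on
  the face and drives the other entries to 0, their value from index 1 on.\<close>

lemma P_exp_closure: "P (Suc n) \<in> exp_closure A w features"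
  unfolding exp_closure_def
proof (intro CollectI allI impI)
  fix \<epsilon> :: real assume e: "\<epsilon> > 0"
  obtain \<theta> where \<theta>: "\<And>a. a \<in> face \<Longrightarrow> P (Suc n) a = w a * exp (\<Sum>i\<in>UNIV. \<theta> i * \<psi> a i)"
    using P_face_exp by blast
  define F where "F N a = (\<Sum>i\<in>UNIV. (\<theta> i - (if \<eta> i = 0 then N else 0)) * \<psi> a i)" for N a
  \<comment> \<open>For \<open>a \<in> A\<close> this is 0 on the face and positive off it, so
    \<open>F N a\<close> is constant in \<open>N\<close> or tends to minus infinity.\<close>
  define Z where "Z a = (\<Sum>i | \<eta> i = 0. \<psi> a i)" for a
  have F: "F N a = (\<Sum>i\<in>UNIV. \<theta> i * \<psi> a i) - N * Z a" for N a
  proof -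
    have "(\<Sum>i\<in>UNIV. (if \<eta> i = 0 then N else 0) * \<psi> a i) = (\<Sum>i | \<eta> i = 0. N * \<psi> a i)"
      by (intro sum.mono_neutral_cong_right) auto
    then show ?thesis by (simp add: F_def Z_def left_diff_distrib sum_subtractf sum_distrib_left)
  qed
  have lim: "((\<lambda>N. w a * exp (F N a)) \<longlongrightarrow> P (Suc n) a) at_top" if a: "a \<in> A" for a
  proof (cases "a \<in> face")
    case True
    then have "Z a = 0" by (auto simp: Z_def face_def)
    then show ?thesis using \<theta>[OF True] by (simp add: F)
  next
    case False
    then obtain i where i: "\<eta> i = 0" "\<psi> a i \<noteq> 0" using a by (auto simp: face_def)
    then have "Z a > 0"
      unfolding Z_def using \<psi>_nonneg[OF a] by (intro sum_pos2[of _ i]) (auto simp: less_le)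
    then have "filterlim (\<lambda>N. (\<Sum>i\<in>UNIV. \<theta> i * \<psi> a i) + (- Z a) * N) at_bot at_top"
      by (intro filterlim_tendsto_add_at_bot_iff[OF tendsto_const, THEN iffD2]
        filterlim_tendsto_neg_mult_at_bot[OF tendsto_const _ filterlim_ident]) simp
    then have "filterlim (\<lambda>N. F N a) at_bot at_top"
      by (simp add: F algebra_simps)
    then have "((\<lambda>N. w a * exp (F N a)) \<longlongrightarrow> w a * 0) at_top"
      by (intro tendsto_mult tendsto_const filterlim_compose[OF exp_at_bot])
    then show ?thesis using P_off_face[OF a False] by simp
  qed
  have "\<forall>\<^sub>F N in at_top. dist (w a * exp (F N a)) (P (Suc n) a) < \<epsilon>" if "a \<in> A" for a
    using tendstoD[OF lim[OF that] e] .
  then have "\<forall>\<^sub>F N in at_top. \<forall>a\<in>A. dist (w a * exp (F N a)) (P (Suc n) a) < \<epsilon>"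
    using finite_A by (simp add: eventually_ball_finite)
  then obtain N where "\<forall>a\<in>A. dist (w a * exp (F N a)) (P (Suc n) a) < \<epsilon>"
    using eventually_happens'[OF trivial_limit_at_top_linorder] by blast
  then have "\<forall>a\<in>A. \<bar>P (Suc n) a - w a * exp (F N a)\<bar> < \<epsilon>"
    by (simp add: dist_real_def abs_minus_commute)
  moreover have "F N \<in> features" unfolding features_def F_def by (rule rangeI)
  ultimately show "\<exists>f\<in>features. \<forall>a\<in>A. \<bar>P (Suc n) a - w a * exp (f a)\<bar> < \<epsilon>" by blast
qed

theorem P_convergent:
  "\<exists>l \<in> exp_closure A w features. (\<forall>i. (\<Sum>a\<in>A. l a * \<psi> a i) = \<eta> i) \<and> (\<forall>a\<in>A. (\<lambda>n. P n a) \<longlonglongrightarrow> l a)"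
proof -
  have bd: "\<bar>P (Suc n) a\<bar> \<le> 1" if "a \<in> A" for n a
    using P_le_1[OF that] P_nonneg[OF that] by simp
  have limit: "l \<in> exp_closure A w features \<and> (\<forall>i. (\<Sum>a\<in>A. l a * \<psi> a i) = \<eta> i)"
    if r: "strict_mono r" and l: "\<And>a. a \<in> A \<Longrightarrow> (\<lambda>n. P (Suc (r n)) a) \<longlonglongrightarrow> l a" for l r
  proof (intro conjI allI)
    show "l \<in> exp_closure A w features"
      using exp_closure_limit[OF finite_A P_exp_closure l] .
    fix i
    have "(\<lambda>n. m (Suc (r n)) i) \<longlonglongrightarrow> (\<Sum>a\<in>A. l a * \<psi> a i)"
      unfolding m_eq by (intro tendsto_sum tendsto_mult tendsto_const l)
    moreover have "(\<lambda>n. m (Suc (r n)) i) \<longlonglongrightarrow> \<eta> i"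
      using LIMSEQ_subseq_LIMSEQ[OF m_tendsto r] by (simp add: o_def)
    ultimately show "(\<Sum>a\<in>A. l a * \<psi> a i) = \<eta> i" by (rule LIMSEQ_unique)
  qed
  obtain l r where lr: "strict_mono r" "\<forall>a\<in>A. (\<lambda>n. P (Suc (r n)) a) \<longlonglongrightarrow> l a"
    using bounded_convergent_subsequence[OF finite_A, of "\<lambda>n. P (Suc n)" 1] bd by blast
  then have l: "l \<in> exp_closure A w features" "\<And>i. (\<Sum>a\<in>A. l a * \<psi> a i) = \<eta> i"
    using limit by blast+
  have Suc: "(\<lambda>n. P (Suc n) a) \<longlonglongrightarrow> l a" if "a \<in> A" for a
  proof (rule convergent_if_unique_limit_point[OF finite_A bd _ that])
    fix l' s c
    assume s: "strict_mono s" "\<And>a. a \<in> A \<Longrightarrow> (\<lambda>n. P (Suc (s n)) a) \<longlonglongrightarrow> l' a" and c: "c \<in> A"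
    have l': "l' \<in> exp_closure A w features" "\<And>i. (\<Sum>a\<in>A. l' a * \<psi> a i) = \<eta> i"
      using limit[OF s] by blast+
    \<comment> \<open>Pairing with a feature depends on the moments alone, so two limit points
      cannot be told apart by features.\<close>
    have eq: "(\<Sum>a\<in>A. k a * (\<Sum>i\<in>UNIV. \<theta> i * \<psi> a i)) = (\<Sum>i\<in>UNIV. \<theta> i * (\<Sum>a\<in>A. k a * \<psi> a i))"
      for k \<theta>
      unfolding sum_distrib_left by (subst sum.swap) (simp add: mult_ac)
    show "l' c = l c"
    proof (rule exp_closure_unique[OF finite_A w_pos l'(1) l(1) _ c])
      fix f assume "f \<in> features"
      then show "(\<Sum>a\<in>A. l' a * f a) = (\<Sum>a\<in>A. l a * f a)"
        using l'(2) l(2) by (auto simp: features_def eq)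
    qed
  qed
  have "\<forall>a\<in>A. (\<lambda>n. P n a) \<longlonglongrightarrow> l a" by (intro ballI, rule LIMSEQ_imp_Suc, rule Suc)
  then show ?thesis using l by blast
qed

end

section \<open>Toric patches\<close>

text \<open>The vector \<open>u\<close> is the coordinatewise logarithm of a torus point; the
  constant \<open>c\<close> accounts for rescaling homogeneous coordinates.\<close>

definition affine_functions :: "(int ^ 'd \<Rightarrow> real) set" where
  "affine_functions = range (\<lambda>(c, u) a. c + u \<bullet> of_int_vec a)"

lemma affine_functionsE:
  assumes "f \<in> affine_functions"
  obtains c u where "f = (\<lambda>a. c + u \<bullet> of_int_vec a)"
  using assms by (auto simp: affine_functions_def)

lemma affine_functionsI: "(\<lambda>a. c + u \<bullet> of_int_vec a) \<in> affine_functions"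
  unfolding affine_functions_def by (rule range_eqI[of _ _ "(c, u)"]) simp

lemma affine_functions_add_const: "f \<in> affine_functions \<Longrightarrow> (\<lambda>a. k + f a) \<in> affine_functions"
  using affine_functionsI[of "k + _"] by (auto elim!: affine_functionsE simp: add.assoc)

text \<open>Pairing with an affine function involves only total mass and first moment. Geometrically
  this is injectivity of the tautological projection.\<close>

lemma affine_exp_closure_unique:
  fixes A :: "(int ^ 'd) set"
  assumes "finite A" and "\<And>a. a \<in> A \<Longrightarrow> w a > 0"
    and "p \<in> exp_closure A w affine_functions" and "q \<in> exp_closure A w affine_functions"
    and "sum p A = sum q A" and "(\<Sum>a\<in>A. p a *\<^sub>R of_int_vec a) = (\<Sum>a\<in>A. q a *\<^sub>R of_int_vec a)"
    and "a \<in> A"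
  shows "p a = q a"
proof (rule exp_closure_unique[OF assms(1-4) _ assms(7)])
  have eq: "(\<Sum>a\<in>A. k a * (c + u \<bullet> of_int_vec a)) = c * sum k A + u \<bullet> (\<Sum>a\<in>A. k a *\<^sub>R of_int_vec a)"
    for k c and u :: "real ^ 'd"
    by (simp add: inner_sum_right distrib_left sum.distrib sum_distrib_left mult.commute)
  fix f :: "int ^ 'd \<Rightarrow> real" assume "f \<in> affine_functions"
  then show "(\<Sum>a\<in>A. p a * f a) = (\<Sum>a\<in>A. q a * f a)"
    using assms(5,6) by (elim affine_functionsE) (simp add: eq)
qed

section \<open>Projective points and the torus image\<close>

lemma proj_point_subset:
  assumes "c \<noteq> 0" "\<And>a. a \<in> A \<Longrightarrow> y a = c * z a"
  shows "proj_point A y \<subseteq> proj_point A z"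
proof
  fix v assume "v \<in> proj_point A y"
  then obtain k where "v = restrict (\<lambda>a. k * y a) A" "k \<noteq> 0" by (auto simp: proj_point_def)
  then have "v = restrict (\<lambda>a. (k * c) * z a) A" "k * c \<noteq> 0" using assms by (auto simp: restrict_def)
  then show "v \<in> proj_point A z" unfolding proj_point_def by blast
qed

lemma proj_point_eq_iff:
  "proj_point A y = proj_point A z \<longleftrightarrow> (\<exists>c. c \<noteq> 0 \<and> (\<forall>a\<in>A. y a = c * z a))"
proof
  assume eq: "proj_point A y = proj_point A z"
  have "restrict (\<lambda>a. 1 * y a) A \<in> proj_point A z"
    unfolding eq[symmetric] unfolding proj_point_def by (intro CollectI exI[of _ 1]) simp
  then obtain c where c: "c \<noteq> 0" "restrict (\<lambda>a. 1 * y a) A = restrict (\<lambda>a. c * z a) A"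
    unfolding proj_point_def mem_Collect_eq by (elim exE conjE) (rule that)
  have "y a = c * z a" if "a \<in> A" for a
    using fun_cong[OF c(2), of a] that by simp
  then show "\<exists>c. c \<noteq> 0 \<and> (\<forall>a\<in>A. y a = c * z a)" using c(1) by blast
next
  assume "\<exists>c. c \<noteq> 0 \<and> (\<forall>a\<in>A. y a = c * z a)"
  then obtain c where c: "c \<noteq> 0" "\<And>a. a \<in> A \<Longrightarrow> y a = c * z a" by blast
  have "z a = (1 / c) * y a" if "a \<in> A" for a using c that by simp
  then show "proj_point A y = proj_point A z"
    using proj_point_subset[of c A y z, OF c] proj_point_subset[of "1 / c" A z y] c(1) by simp
qed

lemma monomial_exp: "monomial (\<chi> i. exp (u $ i)) a = exp (u \<bullet> of_int_vec a)"
  by (simp add: monomial_def inner_vec_def of_int_vec_def exp_sum exp_power_int mult.commute)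

text \<open>The substitution \<open>x = exp u\<close> turns monomials into exponentials of linear
  forms, and a projective point forgets the common factor \<open>exp c\<close>.\<close>

lemma torus_image_eq:
  fixes A :: "(int ^ 'd) set"
  shows "(\<lambda>x. proj_point A (\<lambda>a. w a * monomial x a)) ` {x. \<forall>i. x $ i > 0} =
    (\<lambda>f. proj_point A (\<lambda>a. w a * exp (f a))) ` affine_functions"
    (is "?L = ?R")
proof
  show "?L \<subseteq> ?R"
  proof
    fix P assume "P \<in> ?L"
    then obtain x where x: "\<And>i. x $ i > 0" "P = proj_point A (\<lambda>a. w a * monomial x a)" by blast
    have "x = (\<chi> i. exp ((\<chi> i. ln (x $ i)) $ i))" using x(1) by (simp add: vec_eq_iff)
    then have "monomial x a = exp ((\<chi> i. ln (x $ i)) \<bullet> of_int_vec a)" for a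
      by (metis monomial_exp)
    then show "P \<in> ?R"
      using x(2) affine_functionsI[of 0] by (intro image_eqI[where x = "\<lambda>a. 0 + (\<chi> i. ln (x $ i)) \<bullet> of_int_vec a"]) auto
  qed
  show "?R \<subseteq> ?L"
  proof
    fix P assume "P \<in> ?R"
    then obtain c and u :: "real ^ 'd" where P: "P = proj_point A (\<lambda>a. w a * exp (c + u \<bullet> of_int_vec a))"
      by (auto elim!: affine_functionsE)
    have "P = proj_point A (\<lambda>a. w a * monomial (\<chi> i. exp (u $ i)) a)"
      unfolding P proj_point_eq_iff by (intro exI[of _ "exp c"]) (simp add: monomial_exp exp_add)
    then show "P \<in> ?L" by (intro image_eqI[where x = "\<chi> i. exp (u $ i)"]) auto
  qed
qed

lemma proj_point_exp_closure_normalize: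
  assumes A: "finite A" and w: "\<And>a. a \<in> A \<Longrightarrow> w a > 0"
    and k: "k \<in> exp_closure A w affine_functions" "\<exists>a\<in>A. k a \<noteq> 0"
  shows "\<exists>p\<in>exp_closure A w affine_functions. sum p A = 1 \<and> proj_point A k = proj_point A p"
proof -
  have nn: "k a \<ge> 0" if "a \<in> A" for a
    using exp_closure_nonneg[OF k(1) that] w[OF that] by simp
  then have s: "sum k A > 0"
    using k(2) A by (metis less_le sum_nonneg sum_nonneg_eq_0_iff)
  have "(\<lambda>a. (1 / sum k A) * k a) \<in> exp_closure A w affine_functions"
    using s by (intro exp_closure_scale k(1) affine_functions_add_const) auto
  moreover have "(\<Sum>a\<in>A. (1 / sum k A) * k a) = 1"
    using s by (simp add: sum_divide_distrib[symmetric])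
  moreover have "proj_point A k = proj_point A (\<lambda>a. (1 / sum k A) * k a)"
    unfolding proj_point_eq_iff using s by (intro exI[of _ "sum k A"]) auto
  ultimately show ?thesis by blast
qed

text \<open>A vector that no approximant meets within \<open>\<epsilon>\<close> has a box of radius
  \<open>\<epsilon> / 2\<close> avoiding the closure. The sign \<open>\<sigma>\<close> is there
  because a point of the patch also has negated coordinate vectors.\<close>

lemma openin_exp_closure_compl:
  assumes A: "finite A" and \<sigma>: "\<bar>\<sigma>\<bar> = 1"
  shows "openin (product_topology (\<lambda>_. euclideanreal) A)
    {y \<in> A \<rightarrow>\<^sub>E UNIV. (\<lambda>a. \<sigma> * y a) \<notin> exp_closure A w V}"
  unfolding openin_product_topology_alt
proof
  fix y assume y: "y \<in> {y \<in> A \<rightarrow>\<^sub>E UNIV. (\<lambda>a. \<sigma> * y a) \<notin> exp_closure A w V}"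
  then obtain \<epsilon> where e: "\<epsilon> > 0" "\<not> (\<exists>f\<in>V. \<forall>a\<in>A. \<bar>\<sigma> * y a - w a * exp (f a)\<bar> < \<epsilon>)"
    unfolding exp_closure_def by blast
  have "(\<lambda>a. \<sigma> * z a) \<notin> exp_closure A w V" if z: "z \<in> (\<Pi>\<^sub>E a\<in>A. ball (y a) (\<epsilon> / 2))" for z
  proof
    assume "(\<lambda>a. \<sigma> * z a) \<in> exp_closure A w V"
    then obtain f where f: "f \<in> V" "\<And>a. a \<in> A \<Longrightarrow> \<bar>\<sigma> * z a - w a * exp (f a)\<bar> < \<epsilon> / 2"
      using exp_closureD e(1) by (metis half_gt_zero)
    have "\<bar>\<sigma> * y a - w a * exp (f a)\<bar> < \<epsilon>" if a: "a \<in> A" for a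
    proof -
      have "\<bar>\<sigma> * y a - \<sigma> * z a\<bar> = \<bar>y a - z a\<bar>"
        using \<sigma> by (simp add: right_diff_distrib[symmetric] abs_mult)
      also have "\<dots> < \<epsilon> / 2" using PiE_mem[OF z a] by (simp add: dist_real_def)
      finally show ?thesis using f(2)[OF a] by linarith
    qed
    then show False using e(2) f(1) by blast
  qed
  then show "\<exists>U. finite {i \<in> A. U i \<noteq> topspace euclideanreal} \<and> (\<forall>i\<in>A. openin euclideanreal (U i)) \<and>
      y \<in> Pi\<^sub>E A U \<and> Pi\<^sub>E A U \<subseteq> {y \<in> A \<rightarrow>\<^sub>E UNIV. (\<lambda>a. \<sigma> * y a) \<notin> exp_closure A w V}"
    using A y e(1) by (intro exI[of _ "\<lambda>a. ball (y a) (\<epsilon> / 2)"]) (auto simp: PiE_iff)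
qed

text \<open>The right side is closed and contains the torus image, hence its closure. Conversely,
  every neighbourhood of a point on the right contains an approximant from the torus image.\<close>

lemma toric_patch_eq:
  fixes A :: "(int ^ 'd) set"
  assumes A: "finite A" "A \<noteq> {}" and w: "\<And>a. a \<in> A \<Longrightarrow> w a > 0"
  shows "toric_patch A w = proj_point A ` {p \<in> exp_closure A w affine_functions. sum p A = 1}"
proof -
  define K where "K = exp_closure A w affine_functions"
  define T where "T = proj_point A ` {p \<in> K. sum p A = 1}"
  define R where "R = (\<lambda>f. proj_point A (\<lambda>a. w a * exp (f a))) ` affine_functions"
  have patch: "toric_patch A w = proj_topology A closure_of R"
    unfolding toric_patch_def torus_image_eq R_def ..
  have scale: "(\<lambda>a. c * p a) \<in> K" if "p \<in> K" "c > 0" for c p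
    using that unfolding K_def by (intro exp_closure_scale affine_functions_add_const) auto
  have normalize: "proj_point A k \<in> T" if "k \<in> K" "\<exists>a\<in>A. k a \<noteq> 0" for k
    using proj_point_exp_closure_normalize[where w = w and k = k, OF A(1) w] that unfolding K_def T_def by auto
  have restrict: "proj_point A (restrict p A) = proj_point A p" for p
    unfolding proj_point_eq_iff by (intro exI[of _ 1]) auto
  have T_proj: "T \<subseteq> proj_space A"
  proof
    fix P assume "P \<in> T"
    then obtain p where p: "P = proj_point A p" "sum p A = 1" by (auto simp: T_def)
    then have "\<exists>a\<in>A. p a \<noteq> 0" by (metis sum.neutral zero_neq_one)
    then have "restrict p A \<in> homog_coords A" by (auto simp: homog_coords_def)
    then show "P \<in> proj_space A" unfolding p(1) proj_space_def using restrict[of p] by (metis imageI)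
  qed
  \<comment> \<open>\<open>K\<close> is stable under positive scaling, so of the scalar relating
    \<open>y\<close> to a point of \<open>K\<close> only the sign matters.\<close>
  have T_iff: "proj_point A y \<in> T \<longleftrightarrow> (\<lambda>a. 1 * y a) \<in> K \<or> (\<lambda>a. - 1 * y a) \<in> K"
    if y: "y \<in> homog_coords A" for y
  proof
    assume "proj_point A y \<in> T"
    then obtain p c where p: "p \<in> K" "c \<noteq> 0" "\<forall>a\<in>A. y a = c * p a"
      unfolding T_def by (auto simp: proj_point_eq_iff)
    show "(\<lambda>a. 1 * y a) \<in> K \<or> (\<lambda>a. - 1 * y a) \<in> K"
    proof (cases "c > 0")
      case True
      have "(\<lambda>a. 1 * y a) \<in> K \<longleftrightarrow> (\<lambda>a. c * p a) \<in> K"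
        unfolding K_def using p(3) by (intro exp_closure_cong) simp
      then show ?thesis using scale[OF p(1) True] by blast
    next
      case False
      have "(\<lambda>a. - 1 * y a) \<in> K \<longleftrightarrow> (\<lambda>a. - c * p a) \<in> K"
        unfolding K_def using p(3) by (intro exp_closure_cong) simp
      then show ?thesis using scale[OF p(1), of "- c"] False p(2) by simp
    qed
  next
    have nz: "\<exists>a\<in>A. y a \<noteq> 0" using y by (simp add: homog_coords_def)
    have "proj_point A y = proj_point A (\<lambda>a. \<sigma> * y a)" if "\<sigma> = 1 \<or> \<sigma> = - 1" for \<sigma>
      unfolding proj_point_eq_iff using that by (intro exI[of _ \<sigma>]) auto
    moreover assume "(\<lambda>a. 1 * y a) \<in> K \<or> (\<lambda>a. - 1 * y a) \<in> K"
    ultimately show "proj_point A y \<in> T"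
      using normalize[of "\<lambda>a. 1 * y a"] normalize[of "\<lambda>a. - 1 * y a"] nz by fastforce
  qed
  have "closedin (proj_topology A) T"
  proof -
    define O' where "O' \<sigma> = {y \<in> A \<rightarrow>\<^sub>E UNIV. (\<lambda>a. \<sigma> * y a) \<notin> K}" for \<sigma>
    have "openin (product_topology (\<lambda>_. euclideanreal) A) (O' 1 \<inter> O' (- 1))"
      unfolding O'_def K_def by (intro openin_Int openin_exp_closure_compl A) auto
    then have "openin (homog_topology A) ((O' 1 \<inter> O' (- 1)) \<inter> homog_coords A)"
      unfolding homog_topology_def by (rule openin_subtopology_Int)
    also have "(O' 1 \<inter> O' (- 1)) \<inter> homog_coords A =
        {y \<in> homog_coords A. proj_point A y \<in> proj_space A - T}"
      using T_iff by (auto simp: O'_def proj_space_def homog_coords_def)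
    finally show ?thesis
      using T_proj by (simp add: closedin_def openin_proj_topology)
  qed
  moreover have "R \<subseteq> T"
  proof
    fix P assume "P \<in> R"
    then obtain f where f: "f \<in> affine_functions" "P = proj_point A (\<lambda>a. w a * exp (f a))"
      by (auto simp: R_def)
    have "(\<lambda>a. w a * exp (f a)) \<in> K"
      unfolding K_def exp_closure_def using f(1) by (auto intro!: bexI[of _ f])
    moreover have "\<exists>a\<in>A. w a * exp (f a) \<noteq> 0" using A(2) w by fastforce
    ultimately show "P \<in> T" unfolding f(2) by (rule normalize)
  qed
  ultimately have "toric_patch A w \<subseteq> T"
    unfolding patch by (intro closure_of_minimal)
  moreover have "T \<subseteq> toric_patch A w"
  proof
    fix Q assume Q: "Q \<in> T"
    then obtain p where p: "p \<in> K" "sum p A = 1" "Q = proj_point A p" by (auto simp: T_def)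
    then have "\<exists>a\<in>A. p a \<noteq> 0" by (metis sum.neutral zero_neq_one)
    then have ph: "restrict p A \<in> homog_coords A" by (auto simp: homog_coords_def)
    have "\<exists>P. P \<in> R \<and> P \<in> U" if U: "Q \<in> U" "openin (proj_topology A) U" for U
    proof -
      obtain W where W: "openin (product_topology (\<lambda>_. euclideanreal) A) W"
        "{y \<in> homog_coords A. proj_point A y \<in> U} = W \<inter> homog_coords A"
        using U(2) unfolding openin_proj_topology homog_topology_def openin_subtopology by blast
      have "restrict p A \<in> W" using W(2) ph U(1) p(3) restrict[of p] by auto
      then obtain B where B: "\<And>a. a \<in> A \<Longrightarrow> open (B a)" "restrict p A \<in> Pi\<^sub>E A B" "Pi\<^sub>E A B \<subseteq> W"
        using W(1) unfolding openin_product_topology_alt by (metis open_openin)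
      have "\<exists>e>0. ball (p a) e \<subseteq> B a" if a: "a \<in> A" for a
        using B(1)[OF a] PiE_mem[OF B(2) a] a by (simp add: open_contains_ball)
      then obtain e where e: "\<And>a. a \<in> A \<Longrightarrow> e a > 0 \<and> ball (p a) (e a) \<subseteq> B a"
        by metis
      \<comment> \<open>The least of the finitely many radii serves all coordinates at once.\<close>
      define \<epsilon> where "\<epsilon> = Min (e ` A)"
      have "\<epsilon> > 0" using A e by (simp add: \<epsilon>_def)
      then obtain f where f: "f \<in> affine_functions" "\<And>a. a \<in> A \<Longrightarrow> \<bar>p a - w a * exp (f a)\<bar> < \<epsilon>"
        using exp_closureD[OF p(1)[unfolded K_def]] by blast
      define z where "z = restrict (\<lambda>a. w a * exp (f a)) A"
      have "z a \<in> B a" if a: "a \<in> A" for a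
      proof -
        have "\<epsilon> \<le> e a" using A a by (simp add: \<epsilon>_def)
        then have "z a \<in> ball (p a) (e a)" using f(2)[OF a] a by (simp add: z_def dist_real_def)
        then show ?thesis using e[OF a] by blast
      qed
      then have "z \<in> W" using B(3) by (auto simp: z_def PiE_iff)
      moreover have "z \<in> homog_coords A"
        using A(2) w by (fastforce simp: z_def homog_coords_def)
      ultimately have "proj_point A z \<in> U" using W(2) by blast
      moreover have "proj_point A z \<in> R"
        unfolding z_def restrict R_def using f(1) by blast
      ultimately show ?thesis by blast
    qed
    then show "Q \<in> toric_patch A w"
      unfolding patch in_closure_of using T_proj Q by auto
  qed
  ultimately show ?thesis unfolding T_def K_def by blast
qed

section \<open>Homogenization\<close>

lemma inj_of_int_vec: "inj of_int_vec"
  by (auto simp: inj_def of_int_vec_def vec_eq_iff)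

lemma polytope_of_eq:
  fixes A :: "(int ^ 'd) set"
  assumes "finite A"
  shows "polytope_of A = {x. \<exists>q. (\<forall>a\<in>A. q a \<ge> 0) \<and> sum q A = 1 \<and> (\<Sum>a\<in>A. q a *\<^sub>R of_int_vec a) = x}"
    (is "_ = ?R")
proof
  \<comment> \<open>Injectivity lets convex weights on the image be reindexed by
    \<open>A\<close>.\<close>
  have inj: "inj_on of_int_vec A" using inj_of_int_vec by (rule inj_on_subset) simp
  show "polytope_of A \<subseteq> ?R"
  proof
    fix x assume "x \<in> polytope_of A"
    then obtain u where u: "\<forall>x\<in>of_int_vec ` A. 0 \<le> u x" "sum u (of_int_vec ` A) = 1"
      "(\<Sum>x\<in>of_int_vec ` A. u x *\<^sub>R x) = x"
      unfolding polytope_of_def using assms by (auto simp: convex_hull_finite)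
    then show "x \<in> ?R"
      by (intro CollectI exI[of _ "u \<circ> of_int_vec"]) (simp add: sum.reindex[OF inj])
  qed
  show "?R \<subseteq> polytope_of A"
    unfolding polytope_of_def
    by (auto intro!: convex_sum[OF assms convex_convex_hull] intro: hull_inc)
qed

lemma coord_sum_simps:
  "coord_sum (x + y) = coord_sum x + coord_sum y" "coord_sum (t *\<^sub>R x) = t * coord_sum x"
  by (simp_all add: coord_sum_def sum.distrib sum_distrib_left)

lemma coord_sum_sum: "coord_sum (sum f S) = (\<Sum>a\<in>S. coord_sum (f a))"
  unfolding coord_sum_def sum_component by (rule sum.swap)

lemma homogenize_simps [simp]:
  "homogenize b t x $ None = 1 - t * (coord_sum x + coord_sum b)"
  "homogenize b t x $ Some j = t * (x $ j + b $ j)"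
  by (simp_all add: homogenize_def coord_sum_simps)

lemma sum_UNIV_option:
  fixes g :: "'i::finite option \<Rightarrow> 'b::comm_monoid_add"
  shows "(\<Sum>i\<in>UNIV. g i) = g None + (\<Sum>j\<in>UNIV. g (Some j))"
  by (simp add: UNIV_option_conv sum.reindex)

lemma sum_homogenize: "(\<Sum>i\<in>UNIV. homogenize b t x $ i) = 1"
  by (simp add: sum_UNIV_option coord_sum_def sum_distrib_left[symmetric] sum.distrib)

lemma homogenize_convex_combination:
  assumes "sum q S = 1"
  shows "(\<Sum>a\<in>S. q a * homogenize b t (v a) $ i) = homogenize b t (\<Sum>a\<in>S. q a *\<^sub>R v a) $ i"
proof (cases i)
  case None
  have "(\<Sum>a\<in>S. q a * homogenize b t (v a) $ i) =
      sum q S * (1 - t * coord_sum b) - t * (\<Sum>a\<in>S. q a * coord_sum (v a))"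
    unfolding None by (simp add: sum_distrib_left sum_distrib_right sum_subtractf[symmetric] algebra_simps)
  then show ?thesis
    using assms unfolding None by (simp add: coord_sum_sum coord_sum_simps algebra_simps)
next
  case (Some j)
  have "(\<Sum>a\<in>S. q a * homogenize b t (v a) $ i) = t * (\<Sum>a\<in>S. q a * v a $ j) + sum q S * (t * b $ j)"
    unfolding Some by (simp add: sum_distrib_left sum_distrib_right sum.distrib[symmetric] algebra_simps)
  then show ?thesis
    using assms unfolding Some by (simp add: algebra_simps)
qed

text \<open>The coordinates of a homogenized vector sum to 1, so adding up the equations gives the
  total mass. Then affinity applies, and \<open>t > 0\<close> can be cancelled in the coordinates
  \<open>Some j\<close>.\<close>

lemma homogenize_moments_eqD:
  assumes "t > 0" and eq: "\<And>i. (\<Sum>a\<in>S. p a * homogenize b t (v a) $ i) = homogenize b t y $ i"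
  shows "sum p S = 1" and "(\<Sum>a\<in>S. p a *\<^sub>R v a) = y"
proof -
  have "sum p S = (\<Sum>a\<in>S. p a * (\<Sum>i\<in>UNIV. homogenize b t (v a) $ i))"
    by (simp add: sum_homogenize)
  also have "\<dots> = (\<Sum>i\<in>UNIV. \<Sum>a\<in>S. p a * homogenize b t (v a) $ i)"
    unfolding sum_distrib_left by (rule sum.swap)
  also have "\<dots> = 1" unfolding eq by (rule sum_homogenize)
  finally show p: "sum p S = 1" .
  have "(\<Sum>a\<in>S. p a *\<^sub>R v a) $ j = y $ j" for j
    using eq[of "Some j"] assms(1) unfolding homogenize_convex_combination[OF p] by simp
  then show "(\<Sum>a\<in>S. p a *\<^sub>R v a) = y" by (simp add: vec_eq_iff)
qed

lemma homogenize_features_affine: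
  fixes b :: "real ^ 'd"
  shows "(\<lambda>a. \<Sum>i\<in>UNIV. \<theta> i * homogenize b t (of_int_vec a) $ i) \<in> affine_functions"
proof -
  define c where "c = \<theta> None * (1 - t * coord_sum b) + (\<Sum>j\<in>UNIV. \<theta> (Some j) * t * b $ j)"
  define u :: "real ^ 'd" where "u = (\<chi> j. t * (\<theta> (Some j) - \<theta> None))"
  have "(\<Sum>i\<in>UNIV. \<theta> i * homogenize b t x $ i) = c + u \<bullet> x" for x
    by (simp add: sum_UNIV_option c_def u_def inner_vec_def coord_sum_def algebra_simps
        sum.distrib sum_subtractf sum_distrib_left)
  then show ?thesis using affine_functionsI[of c u] by simp
qed

lemma homogenizing_exists:
  fixes A :: "(int ^ 'd) set"
  assumes A: "finite A"
  obtains b t where "homogenizing A b t"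
proof -
  \<comment> \<open>This shift exceeds every coordinate of every point of \<open>A\<close> in
    absolute value; afterwards the scale \<open>1 / s\<close> brings the coordinate sums down to at
    most 1.\<close>
  define b :: "real ^ 'd" where "b = (\<chi> i. 1 + (\<Sum>a\<in>A. norm (of_int_vec a)))"
  have pos: "(of_int_vec a + b) $ i > 0" if "a \<in> A" for a i
  proof -
    have "\<bar>of_int_vec a $ i\<bar> \<le> norm (of_int_vec a)" by (rule component_le_norm_cart)
    also have "\<dots> \<le> (\<Sum>a\<in>A. norm (of_int_vec a))" using that A by (intro member_le_sum) auto
    finally show ?thesis by (simp add: b_def)
  qed
  then have nn: "coord_sum (of_int_vec a + b) \<ge> 0" if "a \<in> A" for a
    using that unfolding coord_sum_def by (intro sum_nonneg less_imp_le)
  define s where "s = 1 + (\<Sum>a\<in>A. coord_sum (of_int_vec a + b))"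
  have s: "s > 0" unfolding s_def using nn by (intro add_pos_nonneg sum_nonneg) auto
  have "coord_sum (of_int_vec a + b) \<le> s" if "a \<in> A" for a
    using member_le_sum[of a A "\<lambda>a. coord_sum (of_int_vec a + b)"] that A nn by (simp add: s_def)
  then have "homogenizing A b (1 / s)"
    unfolding homogenizing_def coord_sum_simps(2) using s pos by auto
  then show ?thesis by (rule that)
qed

text \<open>A representation of \<open>y\<close> as a convex combination supplies the
  \<open>q\<close> of the scaling locale. Besides convergence this yields surjectivity of the
  tautological projection.\<close>

lemma ipf_convergent:
  fixes A :: "(int ^ 'd) set"
  assumes A: "finite A" and w: "\<And>a. a \<in> A \<Longrightarrow> w a > 0"
    and bt: "homogenizing A b t" and y: "y \<in> polytope_of A"
  shows "\<exists>p\<in>exp_closure A w affine_functions. sum p A = 1 \<and> (\<Sum>a\<in>A. p a *\<^sub>R of_int_vec a) = y \<and>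
    (\<forall>a\<in>A. (\<lambda>n. ipf A w b t y n a) \<longlonglongrightarrow> p a)"
proof -
  obtain q where q: "\<And>a. a \<in> A \<Longrightarrow> q a \<ge> 0" "sum q A = 1" "(\<Sum>a\<in>A. q a *\<^sub>R of_int_vec a) = y"
    using y unfolding polytope_of_eq[OF A] by blast
  interpret iterative_scaling A w "\<lambda>a i. homogenize b t (of_int_vec a) $ i" q
    "\<lambda>i. homogenize b t y $ i" "ipf A w b t y"
    "\<lambda>n i. (\<Sum>c\<in>A. ipf A w b t y n c *\<^sub>R homogenize b t (of_int_vec c)) $ i"
  proof
    fix a i assume a: "a \<in> A"
    then show "homogenize b t (of_int_vec a) $ i \<ge> 0"
      using bt by (cases i) (auto simp: homogenizing_def coord_sum_simps intro: less_imp_le)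
  next
    fix i show "homogenize b t y $ i = (\<Sum>a\<in>A. q a * homogenize b t (of_int_vec a) $ i)"
      using q(2,3) by (simp only: homogenize_convex_combination)
  next
    fix n i
    show "(\<Sum>c\<in>A. ipf A w b t y n c *\<^sub>R homogenize b t (of_int_vec c)) $ i =
        (\<Sum>c\<in>A. ipf A w b t y n c * homogenize b t (of_int_vec c) $ i)"
      by simp
  qed (use A w q in \<open>simp_all add: sum_homogenize Let_def\<close>)
  have "features \<subseteq> affine_functions"
    unfolding features_def using homogenize_features_affine by blast
  then have "exp_closure A w features \<subseteq> exp_closure A w affine_functions"
    by (rule exp_closure_mono)
  moreover have "t > 0" using bt by (simp add: homogenizing_def)
  ultimately show ?thesis
    using P_convergent homogenize_moments_eqD[where t = t and S = A and b = b and v = of_int_vec and y = y] by blast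
qed

section \<open>Existence, continuity, uniqueness and computation of the parametrization\<close>

theorem corollary4p3:
  fixes A :: "(int ^ 'd) set" and w :: "int ^ 'd \<Rightarrow> real"
  assumes "finite A"
    and "aff_dim (polytope_of A) = int CARD('d)"
    and "\<And>a. a \<in> A \<Longrightarrow> w a > 0"
  shows "\<exists>\<beta>. (parametrization A w \<beta> \<and> normalized A \<beta> \<and> linear_precision A \<beta>) \<and>
    (\<forall>\<gamma>. parametrization A w \<gamma> \<and> normalized A \<gamma> \<and> linear_precision A \<gamma> \<longrightarrow>
      (\<forall>a\<in>A. \<forall>x\<in>polytope_of A. \<gamma> a x = \<beta> a x)) \<and>
    (\<forall>b t. homogenizing A b t \<longrightarrow>
      (\<forall>y\<in>polytope_of A. \<forall>a\<in>A. (\<lambda>n. ipf A w b t y n a) \<longlonglongrightarrow> \<beta> a y))"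
proof -
  note A = assms(1) and w = assms(3)
  define K where "K = exp_closure A w affine_functions"
  define fits where "fits x p \<longleftrightarrow> p \<in> K \<and> sum p A = 1 \<and> (\<Sum>a\<in>A. p a *\<^sub>R of_int_vec a) = x" for x p
  \<comment> \<open>The inverse of the tautological projection in normalized coordinates;
    \<open>fits x\<close> determines the vector on \<open>A\<close> only, hence the choice.\<close>
  define \<beta> where "\<beta> a x = (SOME p. fits x p) a" for a x
  \<comment> \<open>The empty hull has affine dimension -1.\<close>
  have "A \<noteq> {}"
    using assms(2) by (auto simp: polytope_of_def)
  then have patch: "toric_patch A w = proj_point A ` {p \<in> K. sum p A = 1}"
    unfolding K_def using A w by (intro toric_patch_eq)
  have unique: "p a = q a" if "fits x p" "fits x q" "a \<in> A" for x p q a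
    using that affine_exp_closure_unique[where w = w and p = p and q = q and a = a, OF A w] unfolding fits_def K_def by simp
  obtain b0 t0 where "homogenizing A b0 t0" using homogenizing_exists[OF A] by blast
  \<comment> \<open>Existence comes from fitting itself, run with one fixed homogenization.\<close>
  then have "\<exists>p. fits x p" if "x \<in> polytope_of A" for x
    using ipf_convergent[where w = w, OF A w _ that] unfolding fits_def K_def by blast
  then have \<beta>: "fits x (\<lambda>a. \<beta> a x)" if "x \<in> polytope_of A" for x
    using that someI_ex[of "fits x"] unfolding \<beta>_def by simp
  have nonneg: "p a \<ge> 0" if "fits x p" "a \<in> A" for x p a
    using exp_closure_nonneg[of p A w _ a] that w[OF that(2)] unfolding fits_def K_def by auto
  have in_polytope: "x \<in> polytope_of A" if "fits x p" for x p
    using that nonneg[OF that] unfolding polytope_of_eq[OF A] fits_def by blast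
  have \<beta>_le: "\<bar>\<beta> a x\<bar> \<le> 1" if "x \<in> polytope_of A" "a \<in> A" for a x
    using member_le_sum[of a A "\<lambda>a. \<beta> a x"] A nonneg[OF \<beta>[OF that(1)]] \<beta>[OF that(1)] that(2)
    unfolding fits_def by fastforce
  \<comment> \<open>The values lie in a bounded range, and every limit point along \<open>X\<close>
    again fits \<open>x\<close>, so uniqueness leaves only \<open>\<beta> a x\<close>.\<close>
  have cont: "continuous_on (polytope_of A) (\<beta> a)" if a: "a \<in> A" for a
    unfolding continuous_on_sequentially
  proof (intro allI ballI impI)
    fix X x assume x: "x \<in> polytope_of A" and X: "(\<forall>n. X n \<in> polytope_of A) \<and> X \<longlonglongrightarrow> x"
    have "(\<lambda>n. \<beta> a (X n)) \<longlonglongrightarrow> \<beta> a x"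
    proof (rule convergent_if_unique_limit_point[OF A, where p = "\<lambda>n a. \<beta> a (X n)" and l = "\<lambda>a. \<beta> a x"])
      show "\<bar>\<beta> c (X n)\<bar> \<le> 1" if "c \<in> A" for n c using \<beta>_le X that by blast
      fix l r c
      assume r: "strict_mono r" and l: "\<And>c. c \<in> A \<Longrightarrow> (\<lambda>n. \<beta> c (X (r n))) \<longlonglongrightarrow> l c" and c: "c \<in> A"
      have fits: "fits (X (r n)) (\<lambda>a. \<beta> a (X (r n)))" for n using \<beta> X by blast
      have "l \<in> K"
        using exp_closure_limit[where p = "\<lambda>n a. \<beta> a (X (r n))" and l = l, OF A _ l] fits
        unfolding fits_def K_def by blast
      moreover have "sum l A = 1"
      proof (rule LIMSEQ_unique)
        show "(\<lambda>n. \<Sum>a\<in>A. \<beta> a (X (r n))) \<longlonglongrightarrow> sum l A" by (intro tendsto_sum l)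
        show "(\<lambda>n. \<Sum>a\<in>A. \<beta> a (X (r n))) \<longlonglongrightarrow> 1" using fits unfolding fits_def by simp
      qed
      moreover have "(\<Sum>a\<in>A. l a *\<^sub>R of_int_vec a) = x"
      proof (rule LIMSEQ_unique)
        show "(\<lambda>n. \<Sum>a\<in>A. \<beta> a (X (r n)) *\<^sub>R of_int_vec a) \<longlonglongrightarrow> (\<Sum>a\<in>A. l a *\<^sub>R of_int_vec a)"
          by (intro tendsto_sum tendsto_scaleR tendsto_const l)
        show "(\<lambda>n. \<Sum>a\<in>A. \<beta> a (X (r n)) *\<^sub>R of_int_vec a) \<longlonglongrightarrow> x"
          using fits LIMSEQ_subseq_LIMSEQ[of X x r] X r unfolding fits_def by (simp add: o_def)
      qed
      ultimately have "fits x l" by (simp add: fits_def)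
      then show "l c = \<beta> c x" using unique \<beta>[OF x] c by blast
    qed (rule a)
    then show "(\<beta> a \<circ> X) \<longlonglongrightarrow> \<beta> a x" by (simp add: o_def)
  qed
  have norm: "normalized A \<beta>"
    using \<beta> by (simp add: normalized_def fits_def)
  moreover have "linear_precision A \<beta>"
    using \<beta> by (simp add: linear_precision_def normalization_def fits_def)
  moreover have "parametrization A w \<beta>"
    unfolding parametrization_def
  proof
    have "\<exists>a\<in>A. \<beta> a x \<noteq> 0" if "x \<in> polytope_of A" for x
      using norm that unfolding normalized_def by (metis sum.neutral zero_neq_one)
    then show "blending_functions A \<beta>"
      using cont nonneg \<beta> unfolding blending_functions_def by blast
    show "(\<lambda>x. proj_point A (\<lambda>a. \<beta> a x)) ` polytope_of A = toric_patch A w"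
      unfolding patch
    proof
      show "(\<lambda>x. proj_point A (\<lambda>a. \<beta> a x)) ` polytope_of A \<subseteq> proj_point A ` {p \<in> K. sum p A = 1}"
        using \<beta> unfolding fits_def by blast
      \<comment> \<open>A normalized point of the patch is the value of the parametrization at its
        own first moment.\<close>
      have "proj_point A p \<in> (\<lambda>x. proj_point A (\<lambda>a. \<beta> a x)) ` polytope_of A" if p: "fits y p" for y p
      proof
        show y: "y \<in> polytope_of A" using p by (rule in_polytope)
        show "proj_point A p = proj_point A (\<lambda>a. \<beta> a y)"
          unfolding proj_point_eq_iff using unique[OF p \<beta>[OF y]] by (intro exI[of _ 1]) simp
      qed
      then show "proj_point A ` {p \<in> K. sum p A = 1} \<subseteq> (\<lambda>x. proj_point A (\<lambda>a. \<beta> a x)) ` polytope_of A"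
        unfolding fits_def by blast
    qed
  qed
  moreover have "\<gamma> a x = \<beta> a x"
    if \<gamma>: "parametrization A w \<gamma>" "normalized A \<gamma>" "linear_precision A \<gamma>"
      and a: "a \<in> A" and x: "x \<in> polytope_of A" for \<gamma> a x
  proof -
    have sum: "(\<Sum>a\<in>A. \<gamma> a x) = 1" using \<gamma>(2) x by (simp add: normalized_def)
    have "proj_point A (\<lambda>a. \<gamma> a x) \<in> toric_patch A w"
      using \<gamma>(1) x unfolding parametrization_def by blast
    then obtain p where p: "p \<in> K" "sum p A = 1" "proj_point A (\<lambda>a. \<gamma> a x) = proj_point A p"
      unfolding patch by blast
    then obtain c where c: "\<forall>a\<in>A. \<gamma> a x = c * p a"
      unfolding proj_point_eq_iff by blast
    \<comment> \<open>Both vectors have sum 1, so the projective scalar is trivial and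
      \<open>\<gamma>\<close> takes values in \<open>K\<close> itself.\<close>
    then have "c = 1" using sum p(2) by (simp add: sum_distrib_left[symmetric])
    then have "(\<lambda>a. \<gamma> a x) \<in> K"
      using p(1) c exp_closure_cong[of A "\<lambda>a. \<gamma> a x" p] unfolding K_def by simp
    moreover have "(\<Sum>a\<in>A. normalization A \<gamma> a x *\<^sub>R of_int_vec a) = x"
      using \<gamma>(3) x by (simp add: linear_precision_def)
    ultimately have "fits x (\<lambda>a. \<gamma> a x)"
      using sum by (simp add: fits_def normalization_def)
    then show ?thesis using unique \<beta>[OF x] a by blast
  qed
  moreover have "(\<lambda>n. ipf A w b t y n a) \<longlonglongrightarrow> \<beta> a y"
    if bt: "homogenizing A b t" and y: "y \<in> polytope_of A" and a: "a \<in> A" for b t y a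
  proof -
    obtain p where "fits y p" "(\<lambda>n. ipf A w b t y n a) \<longlonglongrightarrow> p a"
      using ipf_convergent[where w = w, OF A w bt y] a unfolding fits_def K_def by blast
    then show ?thesis using unique \<beta>[OF y] a by metis
  qed
  ultimately show ?thesis by (intro exI[of _ \<beta>]) blast
qed

end
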